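(* Let $X=(X_A)_{A\in\mathcal A}$ be a set-indexed process with a unique additive extension to $\mathcal C(u)$ and let $(\mathcal F_A)_{A\in\mathcal A}$ be its minimal filtration. Then $X$ is set-Markov if and only if for all $B,B'\in\mathcal A(u)$ with $B\subseteq B'$, the $\sigma$-fields $\mathcal F_B$ and $\sigma(X_{B'})$ are conditionally independent given $\sigma(X_B)$.
   Context: Framework. $T$ is a compact Hausdorff space and $\mathcal A$ is a collection of closed subsets of $T$ with $\emptyset,T\in\mathcal A$, closed under arbitrary intersections, containing no two disjoint non-empty sets, and separable from above: there are finite subcollections $\mathcal A_n\subseteq\mathcal A_{n+1}\subseteq\mathcal A$ closed under intersections and maps $g_n$ sending each $A\in\mathcal A$ to a finite union of sets of $\mathcal A_n$ with $A=\cap_n g_n(A)$, $g_{n+1}(A)\subseteq g_n(A)$, $A\subseteq g_n(A)^0$ (interior), $g_n(\emptyset)=\emptyset$, $g_n(\cap_\alpha A_\alpha)=\cap_\alpha g_n(A_\alpha)$ for arbitrary families, and $\cup_{i=1}^kA_i=\cup_{j=1}^mA'_j\Rightarrow\cup_{i=1}^kg_n(A_i)=\cup_{j=1}^mg_n(A'_j)$. $\mathcal A(u)$ is the class of finite unions of sets of $\mathcal A$; $\mathcal C$ is the class of sets $A\setminus B$ with $A\in\mathcal A$, $B\in\mathcal A(u)$; $\mathcal C(u)$ is the class of finite unions of sets of $\mathcal C$. Processes. A process $X=(X_A)_{A\in\mathcal A}$ is a family of real random variables on a complete probability space. It has a (almost surely) unique additive extension to $\mathcal A(u)$ if, whenever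 $\cup_{i=1}^nA_i=\cup_{j=1}^mA'_j$ with all sets in $\mathcal A$, the inclusion–exclusion sums $\sum_iX_{A_i}-\sum_{i_1<i_2}X_{A_{i_1}\cap A_{i_2}}+\cdots+(-1)^{n+1}X_{A_1\cap\cdots\cap A_n}$ and the analogous sum for the $A'_j$ coincide a.s.; the common value is $X_B$, $B=\cup_iA_i$. It has a unique additive extension to $\mathcal C$ if $A\setminus B=A'\setminus B'$ ($A,A'\in\mathcal A$, $B,B'\in\mathcal A(u)$) implies $X_A-X_{A\cap B}=X_{A'}-X_{A'\cap B'}$ a.s., the common value being $X_{A\setminus B}$ (in particular $X_\emptyset=0$ a.s.). A unique additive extension to $\mathcal C(u)$ means the analogous inclusion–exclusion consistency for finite unions of sets of $\mathcal C$. The minimal filtration is $\mathcal F_B=\sigma(X_A;A\in\mathcal A,A\subseteq B)$, $B\in\mathcal A(u)$ (completed). $X$ is set-Markov if for all $A\in\mathcal A$ and $B\in\mathcal A(u)$, $\mathcal F_B$ and $\sigma(X_{A\setminus B})$ are conditionally independent given $\sigma(X_B)$. *)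

theory Defs
  imports "HOL-Probability.Probability"
begin

section \<open>Indexing collections\<close>

definition finite_unions :: "'a set set \<Rightarrow> 'a set set" where
  "finite_unions \<D> = {\<Union>\<F> |\<F>. finite \<F> \<and> \<F> \<subseteq> \<D>}"

definition closed_under_Inter :: "'a set set \<Rightarrow> bool" where
  "closed_under_Inter \<D> \<longleftrightarrow> (\<forall>\<S>. \<S> \<noteq> {} \<and> \<S> \<subseteq> \<D> \<longrightarrow> \<Inter>\<S> \<in> \<D>)"

definition separable_from_above :: "'a topology \<Rightarrow> 'a set set \<Rightarrow> bool" where
  "separable_from_above T \<A> \<longleftrightarrow>
    (\<exists>(\<A>n :: nat \<Rightarrow> 'a set set) (g :: nat \<Rightarrow> 'a set \<Rightarrow> 'a set). \<forall>n.
       finite (\<A>n n) \<and> \<A>n n \<subseteq> \<A>n (Suc n) \<and> \<A>n n \<subseteq> \<A> \<and> closed_under_Inter (\<A>n n) \<and>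
       (\<forall>A\<in>\<A>. g n A \<in> finite_unions (\<A>n n) \<and> A = (\<Inter>k. g k A) \<and>
          g (Suc n) A \<subseteq> g n A \<and> A \<subseteq> T interior_of (g n A)) \<and>
       g n {} = {} \<and>
       (\<forall>\<S>. \<S> \<noteq> {} \<and> \<S> \<subseteq> \<A> \<longrightarrow> g n (\<Inter>\<S>) = (\<Inter>A\<in>\<S>. g n A)) \<and>
       (\<forall>\<F> \<F>'. finite \<F> \<and> \<F> \<subseteq> \<A> \<and> finite \<F>' \<and> \<F>' \<subseteq> \<A> \<and> \<Union>\<F> = \<Union>\<F>' \<longrightarrow>
          (\<Union>A\<in>\<F>. g n A) = (\<Union>A\<in>\<F>'. g n A)))"

definition indexing_collection :: "'a topology \<Rightarrow> 'a set set \<Rightarrow> bool" where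
  "indexing_collection T \<A> \<longleftrightarrow>
     (\<forall>A\<in>\<A>. closedin T A) \<and> {} \<in> \<A> \<and> topspace T \<in> \<A> \<and> closed_under_Inter \<A> \<and>
     (\<forall>A\<in>\<A>. \<forall>B\<in>\<A>. A \<noteq> {} \<and> B \<noteq> {} \<longrightarrow> A \<inter> B \<noteq> {}) \<and>
     separable_from_above T \<A>"

definition diff_class :: "'a set set \<Rightarrow> 'a set set" where
  "diff_class \<A> = {A - B |A B. A \<in> \<A> \<and> B \<in> finite_unions \<A>}"


section \<open>Additive extensions\<close>

text \<open>Grouping the index sets \<open>I\<close> by cardinality gives the usual alternating sum
  \<open>\<Sum>i. Y (D i) - \<Sum>i<j. Y (D i \<inter> D j) + \<dots>\<close>.\<close>

definition incl_excl :: "('a set \<Rightarrow> 'w \<Rightarrow> real) \<Rightarrow> nat \<Rightarrow> (nat \<Rightarrow> 'a set) \<Rightarrow> 'w \<Rightarrow> real" where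
  "incl_excl Y n D \<omega> =
     (\<Sum>I | I \<subseteq> {1..n} \<and> I \<noteq> {}. (-1) ^ (card I + 1) * Y (\<Inter>i\<in>I. D i) \<omega>)"

definition union_rep :: "'a set set \<Rightarrow> 'a set \<Rightarrow> nat \<Rightarrow> (nat \<Rightarrow> 'a set) \<Rightarrow> bool" where
  "union_rep \<D> S n D \<longleftrightarrow> 1 \<le> n \<and> (\<forall>i\<in>{1..n}. D i \<in> \<D>) \<and> S = (\<Union>i\<in>{1..n}. D i)"

definition diff_rep :: "'a set set \<Rightarrow> 'a set \<Rightarrow> 'a set \<Rightarrow> 'a set \<Rightarrow> bool" where
  "diff_rep \<A> S A B \<longleftrightarrow> A \<in> \<A> \<and> B \<in> finite_unions \<A> \<and> S = A - B"

text \<open>The extensions are determined only up to null sets; a version is fixed by choosing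
  one representation of each set. The consistency conditions below say exactly that any
  other representation yields an almost surely equal random variable.\<close>

definition union_ext :: "'a set set \<Rightarrow> ('a set \<Rightarrow> 'w \<Rightarrow> real) \<Rightarrow> 'a set \<Rightarrow> 'w \<Rightarrow> real" where
  "union_ext \<D> Y S = (case SOME (n, D). union_rep \<D> S n D of (n, D) \<Rightarrow> incl_excl Y n D)"

definition diff_ext :: "'a set set \<Rightarrow> ('a set \<Rightarrow> 'w \<Rightarrow> real) \<Rightarrow> 'a set \<Rightarrow> 'w \<Rightarrow> real" where
  "diff_ext \<A> X S = (case SOME (A, B). diff_rep \<A> S A B of
     (A, B) \<Rightarrow> (\<lambda>\<omega>. X A \<omega> - union_ext \<A> X (A \<inter> B) \<omega>))"

definition union_consistent ::
    "'w measure \<Rightarrow> 'a set set \<Rightarrow> ('a set \<Rightarrow> 'w \<Rightarrow> real) \<Rightarrow> bool" where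
  "union_consistent M \<D> Y \<longleftrightarrow>
     (\<forall>S n D m D'. union_rep \<D> S n D \<and> union_rep \<D> S m D' \<longrightarrow>
        (AE \<omega> in M. incl_excl Y n D \<omega> = incl_excl Y m D' \<omega>))"

text \<open>\<open>X {} = 0\<close> has to be demanded separately: it expresses that the extension to
  differences agrees with \<open>X\<close> on \<open>A = A - {}\<close>, and does not follow from the
  independence of the representation (a non-zero constant process is a counterexample).\<close>

definition diff_consistent ::
    "'w measure \<Rightarrow> 'a set set \<Rightarrow> ('a set \<Rightarrow> 'w \<Rightarrow> real) \<Rightarrow> bool" where
  "diff_consistent M \<A> X \<longleftrightarrow>
     (AE \<omega> in M. X {} \<omega> = 0) \<and>
     (\<forall>S A B A' B'. diff_rep \<A> S A B \<and> diff_rep \<A> S A' B' \<longrightarrow>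
        (AE \<omega> in M. X A \<omega> - union_ext \<A> X (A \<inter> B) \<omega> = X A' \<omega> - union_ext \<A> X (A' \<inter> B') \<omega>))"

definition unique_additive_extension ::
    "'w measure \<Rightarrow> 'a set set \<Rightarrow> ('a set \<Rightarrow> 'w \<Rightarrow> real) \<Rightarrow> bool" where
  "unique_additive_extension M \<A> X \<longleftrightarrow>
     union_consistent M \<A> X \<and> diff_consistent M \<A> X \<and>
     union_consistent M (diff_class \<A>) (diff_ext \<A> X)"


section \<open>Filtration, conditional independence, Markov property\<close>

definition set_indexed_process ::
    "'w measure \<Rightarrow> 'a set set \<Rightarrow> ('a set \<Rightarrow> 'w \<Rightarrow> real) \<Rightarrow> bool" where
  "set_indexed_process M \<A> X \<longleftrightarrow> (\<forall>A\<in>\<A>. X A \<in> borel_measurable M)"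

definition gen_field :: "'w measure \<Rightarrow> ('w \<Rightarrow> real) \<Rightarrow> 'w measure" where
  "gen_field M Z = vimage_algebra (space M) Z borel"

definition min_filtration ::
    "'w measure \<Rightarrow> 'a set set \<Rightarrow> ('a set \<Rightarrow> 'w \<Rightarrow> real) \<Rightarrow> 'a set \<Rightarrow> 'w measure" where
  "min_filtration M \<A> X B =
     sigma (space M) ((\<Union>A\<in>{A\<in>\<A>. A \<subseteq> B}. sets (gen_field M (X A))) \<union> null_sets M)"

definition cond_indep ::
    "'w measure \<Rightarrow> 'w measure \<Rightarrow> 'w measure \<Rightarrow> 'w measure \<Rightarrow> bool" where
  "cond_indep M F G H \<longleftrightarrow>
     subalgebra M F \<and> subalgebra M G \<and> subalgebra M H \<and>
     (\<forall>U\<in>sets F. \<forall>V\<in>sets G. AE \<omega> in M.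
        real_cond_exp M H (indicator (U \<inter> V)) \<omega> =
        real_cond_exp M H (indicator U) \<omega> * real_cond_exp M H (indicator V) \<omega>)"

definition set_markov ::
    "'w measure \<Rightarrow> 'a set set \<Rightarrow> ('a set \<Rightarrow> 'w \<Rightarrow> real) \<Rightarrow> bool" where
  "set_markov M \<A> X \<longleftrightarrow>
     (\<forall>A\<in>\<A>. \<forall>B\<in>finite_unions \<A>.
        cond_indep M (min_filtration M \<A> X B)
          (gen_field M (diff_ext \<A> X (A - B))) (gen_field M (union_ext \<A> X B)))"

end

theory Submission
  imports Defs
begin

text \<open>
  Write \<open>X B\<close> for the additive extension at a finite union \<open>B\<close> and \<open>F B\<close> for its history.
  Inclusion-exclusion gives \<open>X (A - B) = X (A \<union> B) - X B\<close> almost surely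
  (\<open>diff_ext_eq_union_ext_minus\<close>). Hence, once \<open>X B\<close> is given, knowing the increment over
  \<open>A - B\<close> is the same as knowing \<open>X (A \<union> B)\<close>, and the set-Markov property says precisely that
  the history \<open>F B\<close> and the value \<open>X (A \<union> B)\<close> are conditionally independent given \<open>X B\<close>
  (\<open>cond_indep_increment_iff\<close>). This is the asserted property for those \<open>B' \<supseteq> B\<close> that arise
  from \<open>B\<close> by adjoining one set of \<open>\<A>\<close>, which settles one direction.

  For the other direction, a general \<open>B' \<supseteq> B\<close> is reached from \<open>B\<close> by adjoining finitely many
  sets of \<open>\<A>\<close> one after the other. Along this increasing chain the values of \<open>X\<close> form a
  Markov process with respect to the histories, and conditional independence passes from one
  step to several steps as for any Markov chain (\<open>cond_indep_chain\<close>): the future is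
  conditioned first on the intermediate history, where only the intermediate value matters,
  and then on \<open>F B\<close>, where only \<open>X B\<close> matters.

  The measure theory behind both arguments rests on one reformulation
  (\<open>cond_indep_iff_set_integral\<close>): if \<open>H \<subseteq> F\<close>, then \<open>F\<close> and \<open>G\<close> are conditionally independent
  given \<open>H\<close> iff \<open>indicator U\<close> and \<open>E[indicator U | H]\<close> have the same integral over \<open>V\<close>, for all
  \<open>U \<in> F\<close> and \<open>V \<in> G\<close>. For fixed \<open>U\<close> both integrals are additive in \<open>V\<close> and insensitive to
  null sets, so \<open>G\<close> may be enlarged by \<open>H\<close> (\<open>cond_indep_join\<close>) and random variables may be
  replaced by almost surely equal ones (\<open>cond_indep_borel_image\<close>).
\<close>


section \<open>Set integrals and conditional expectations of bounded functions\<close>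

text \<open>The sets on which two integrals agree form a Dynkin class; agreement of the total
  integrals provides closure under complements.\<close>

lemma set_integral_eq_on_sigma_sets:
  fixes f g :: "'w \<Rightarrow> real"
  assumes f: "integrable M f" and g: "integrable M g"
    and stable: "Int_stable \<G>" and sub: "\<G> \<subseteq> sets M"
    and total: "(LINT x|M. f x) = (LINT x|M. g x)"
    and eq: "\<And>A. A \<in> \<G> \<Longrightarrow> (LINT x:A|M. f x) = (LINT x:A|M. g x)"
    and A: "A \<in> sigma_sets (space M) \<G>"
  shows "(LINT x:A|M. f x) = (LINT x:A|M. g x)"
proof -
  have sets: "B \<in> sets M" if "B \<in> sigma_sets (space M) \<G>" for B
    using sets.sigma_sets_subset[OF sub] that by blast
  have set_int: "set_integrable M B h" if "B \<in> sets M" "integrable M h" for B and h :: "'w \<Rightarrow> real"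
    using integrable_mult_indicator[OF that] by (simp add: set_integrable_def)
  have "\<G> \<subseteq> Pow (space M)"
    using sub sets.space_closed by blast
  from stable this A show ?thesis
  proof (induction rule: sigma_sets_induct_disjoint)
    case (basic B)
    then show ?case by (rule eq)
  next
    case empty
    show ?case by (simp add: set_lebesgue_integral_def)
  next
    case (compl B)
    have B: "B \<in> sets M" using compl sets by blast
    have "(LINT x:space M - B|M. h x) = (LINT x|M. h x) - (LINT x:B|M. h x)"
      if "integrable M h" for h :: "'w \<Rightarrow> real"
    proof -
      have "(LINT x:(space M - B) \<union> B|M. h x) = (LINT x:space M - B|M. h x) + (LINT x:B|M. h x)"
        by (rule set_integral_Un) (use B that in \<open>auto intro!: set_int\<close>)
      moreover have "(space M - B) \<union> B = space M"
        using B sets.sets_into_space by blast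
      ultimately show ?thesis by (simp add: set_integral_space that)
    qed
    then show ?case using compl f g total by simp
  next
    case (union B)
    have B: "\<And>i. B i \<in> sets M" using union(2) sets by blast
    have "(LINT x:(\<Union>i. B i)|M. h x) = (\<Sum>i. LINT x:B i|M. h x)"
      if "integrable M h" for h :: "'w \<Rightarrow> real"
      by (rule lebesgue_integral_countable_add)
        (use B that union(1) in \<open>auto simp: disjoint_family_on_def intro!: set_int\<close>)
    then show ?case using union f g by simp
  qed
qed

context prob_space
begin

lemma integrable_mult_bounded:
  fixes f g :: "'a \<Rightarrow> real"
  assumes [measurable]: "f \<in> borel_measurable M" "g \<in> borel_measurable M"
    and "AE x in M. \<bar>f x\<bar> \<le> 1" "AE x in M. \<bar>g x\<bar> \<le> 1"
  shows "integrable M (\<lambda>x. f x * g x)"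
proof (rule integrable_const_bound[where B = 1])
  show "AE x in M. norm (f x * g x) \<le> 1"
    using assms(3,4) by eventually_elim (simp add: abs_mult mult_le_one)
qed measurable

lemma integrable_bounded:
  fixes f :: "'a \<Rightarrow> real"
  assumes "f \<in> borel_measurable M" "AE x in M. \<bar>f x\<bar> \<le> 1"
  shows "integrable M f"
  using integrable_mult_bounded[OF assms(1) _ assms(2), of "\<lambda>_. 1"] by simp

lemma cond_exp_bounded:
  assumes "subalgebra M H" "f \<in> borel_measurable M" "AE x in M. \<bar>f x\<bar> \<le> 1"
  shows "AE x in M. \<bar>real_cond_exp M H f x\<bar> \<le> 1"
proof -
  interpret H: finite_measure_subalgebra M H
    by unfold_locales (rule assms)
  have f: "integrable M f" by (rule integrable_bounded[OF assms(2,3)])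
  have "AE x in M. real_cond_exp M H f x \<le> 1"
    by (rule H.real_cond_exp_le_c[OF f]) (use assms(3) in \<open>auto elim!: eventually_mono\<close>)
  moreover have "AE x in M. real_cond_exp M H f x \<ge> -1"
    by (rule H.real_cond_exp_ge_c[OF f]) (use assms(3) in \<open>auto elim!: eventually_mono\<close>)
  ultimately show ?thesis by eventually_elim simp
qed

text \<open>Conditional expectation is self-adjoint, being an orthogonal projection: both sides
  equal the integral of \<open>E[f | H] * E[g | H]\<close>.\<close>

lemma integral_cond_exp_swap:
  assumes H: "subalgebra M H"
    and f: "f \<in> borel_measurable M" "AE x in M. \<bar>f x\<bar> \<le> 1"
    and g: "g \<in> borel_measurable M" "AE x in M. \<bar>g x\<bar> \<le> 1"
  shows "(LINT x|M. f x * real_cond_exp M H g x) = (LINT x|M. real_cond_exp M H f x * g x)"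
proof -
  interpret H: finite_measure_subalgebra M H
    by unfold_locales (rule H)
  have *: "(LINT x|M. real_cond_exp M H h x * real_cond_exp M H k x) =
      (LINT x|M. real_cond_exp M H h x * k x)"
    if "h \<in> borel_measurable M" "AE x in M. \<bar>h x\<bar> \<le> 1"
       "k \<in> borel_measurable M" "AE x in M. \<bar>k x\<bar> \<le> 1" for h k
    using that cond_exp_bounded[OF H that(1,2)]
    by (intro H.real_cond_exp_intg(2) integrable_mult_bounded) auto
  show ?thesis
    using *[OF f g] *[OF g f] by (simp add: mult.commute)
qed

lemma cond_exp_indicator_Int:
  assumes H: "subalgebra M H" and D: "D \<in> sets H" and U: "U \<in> sets M"
  shows "AE x in M. real_cond_exp M H (indicator (U \<inter> D)) x
    = indicator D x * real_cond_exp M H (indicator U) x"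
proof -
  interpret H: finite_measure_subalgebra M H
    by unfold_locales (rule H)
  have [measurable]: "D \<in> sets M" "U \<in> sets M" using D H U by (auto simp: subalgebra_def)
  have "integrable M (\<lambda>x. indicator D x * indicator U x :: real)"
    by (rule integrable_mult_bounded) (auto simp: indicator_def)
  then have "AE x in M. real_cond_exp M H (\<lambda>x. indicator D x * indicator U x) x
      = indicator D x * real_cond_exp M H (indicator U) x"
    using D by (intro H.real_cond_exp_mult) auto
  moreover have "(\<lambda>x. indicator D x * indicator U x :: real) = indicator (U \<inter> D)"
    by (auto simp: indicator_def)
  ultimately show ?thesis by simp
qed


section \<open>Conditional independence\<close>

text \<open>When the conditioning field \<open>H\<close> lies in \<open>F\<close>, the defining almost sure product formula
  can be tested by one integral identity for each pair of events. This form is additive in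
  \<open>V\<close>, so it can be extended from a generator of \<open>G\<close>. For the converse, test the product
  formula on \<open>D \<in> H\<close> and absorb \<open>D\<close> into \<open>U\<close>.\<close>

lemma cond_indep_iff_set_integral:
  assumes F: "subalgebra M F" and G: "subalgebra M G" and H: "subalgebra M H" and HF: "sets H \<subseteq> sets F"
  shows "cond_indep M F G H \<longleftrightarrow>
    (\<forall>U\<in>sets F. \<forall>V\<in>sets G.
       (LINT x:V|M. indicator U x) = (LINT x:V|M. real_cond_exp M H (indicator U) x))"
    (is "_ \<longleftrightarrow> (\<forall>U\<in>_. \<forall>V\<in>_. ?P U V)")
proof -
  interpret H: finite_measure_subalgebra M H
    by unfold_locales (rule H)
  have sets: "U \<in> sets F \<Longrightarrow> U \<in> sets M" "U \<in> sets G \<Longrightarrow> U \<in> sets M" "U \<in> sets H \<Longrightarrow> U \<in> sets M" for U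
    using F G H by (auto simp: subalgebra_def)
  note int = integrable_mult_bounded cond_exp_bounded[OF H]
  have bd: "AE x in M. \<bar>indicator U x :: real\<bar> \<le> 1" for U
    by (auto simp: indicator_def)
  show ?thesis
  proof (intro iffI ballI)
    fix U V assume ci: "cond_indep M F G H" and U: "U \<in> sets F" and V: "V \<in> sets G"
    note [measurable] = sets(1)[OF U] sets(2)[OF V]
    have "(LINT x:V|M. real_cond_exp M H (indicator U) x)
        = (LINT x|M. real_cond_exp M H (indicator U) x * indicator V x)"
      by (simp add: set_lebesgue_integral_def mult.commute)
    also have "\<dots> = (LINT x|M. real_cond_exp M H (indicator U) x * real_cond_exp M H (indicator V) x)"
      by (rule H.real_cond_exp_intg(2)[symmetric]) (auto intro!: int simp: bd)
    also have "\<dots> = (LINT x|M. real_cond_exp M H (indicator (U \<inter> V)) x)"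
    proof (rule integral_cong_AE)
      have "AE x in M. real_cond_exp M H (indicator (U \<inter> V)) x
          = real_cond_exp M H (indicator U) x * real_cond_exp M H (indicator V) x"
        using ci U V unfolding cond_indep_def by blast
      then show "AE x in M. real_cond_exp M H (indicator U) x * real_cond_exp M H (indicator V) x
          = real_cond_exp M H (indicator (U \<inter> V)) x"
        by eventually_elim simp
    qed measurable
    also have "\<dots> = (LINT x|M. indicator (U \<inter> V) x)"
      by (rule H.real_cond_exp_int(2)) (auto intro!: integrable_bounded simp: bd)
    also have "\<dots> = (LINT x:V|M. indicator U x)"
      by (simp add: set_lebesgue_integral_def indicator_inter_arith mult.commute)
    finally show "?P U V" by simp
  next
    assume *: "\<forall>U\<in>sets F. \<forall>V\<in>sets G. ?P U V"
    have "AE x in M. real_cond_exp M H (indicator (U \<inter> V)) x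
        = real_cond_exp M H (indicator U) x * real_cond_exp M H (indicator V) x"
      if U: "U \<in> sets F" and V: "V \<in> sets G" for U V
    proof (rule H.real_cond_exp_charact)
      note [measurable] = sets(1)[OF U] sets(2)[OF V]
      show "integrable M (indicator (U \<inter> V) :: 'a \<Rightarrow> real)"
        by (auto intro!: integrable_bounded simp: bd)
      show "integrable M (\<lambda>x. real_cond_exp M H (indicator U) x * real_cond_exp M H (indicator V) x)"
        by (auto intro!: int simp: bd)
      show "(\<lambda>x. real_cond_exp M H (indicator U) x * real_cond_exp M H (indicator V) x) \<in> borel_measurable H"
        by simp
      fix D assume D: "D \<in> sets H"
      note [measurable] = sets(3)[OF D] D
      have UD: "U \<inter> D \<in> sets F" using U D HF by blast
      have ce: "AE x in M. real_cond_exp M H (indicator (U \<inter> D)) x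
          = indicator D x * real_cond_exp M H (indicator U) x"
        by (rule cond_exp_indicator_Int[OF H D]) simp
      have bd': "AE x in M. \<bar>indicator D x * real_cond_exp M H (indicator U) x\<bar> \<le> 1"
      proof -
        have "AE x in M. \<bar>real_cond_exp M H (indicator U) x\<bar> \<le> 1"
          by (auto intro!: int simp: bd)
        then show ?thesis by eventually_elim (auto simp: indicator_def)
      qed
      have "(LINT x:D|M. indicator (U \<inter> V) x) = (LINT x:V|M. indicator (U \<inter> D) x :: real)"
        by (simp add: set_lebesgue_integral_def indicator_inter_arith mult_ac)
      also have "\<dots> = (LINT x:V|M. real_cond_exp M H (indicator (U \<inter> D)) x)"
        using * UD V by simp
      also have "\<dots> = (LINT x|M. (indicator D x * real_cond_exp M H (indicator U) x) * indicator V x)"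
        unfolding set_lebesgue_integral_def
        by (rule integral_cong_AE) (use ce in \<open>auto elim!: eventually_mono\<close>)
      also have "\<dots> = (LINT x|M. (indicator D x * real_cond_exp M H (indicator U) x)
          * real_cond_exp M H (indicator V) x)"
        by (rule H.real_cond_exp_intg(2)[symmetric]) (use bd' in \<open>auto intro!: int simp: bd\<close>)
      also have "\<dots> = (LINT x:D|M. real_cond_exp M H (indicator U) x * real_cond_exp M H (indicator V) x)"
        by (simp add: set_lebesgue_integral_def mult_ac)
      finally show "(LINT x:D|M. indicator (U \<inter> V) x)
        = (LINT x:D|M. real_cond_exp M H (indicator U) x * real_cond_exp M H (indicator V) x)" .
    qed
    then show "cond_indep M F G H"
      using F G H by (simp add: cond_indep_def)
  qed
qed

lemma cond_indep_self:
  assumes F: "subalgebra M F" and H: "subalgebra M H" and HF: "sets H \<subseteq> sets F"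
  shows "cond_indep M F H H"
proof -
  interpret H: finite_measure_subalgebra M H
    by unfold_locales (rule H)
  show ?thesis
    unfolding cond_indep_iff_set_integral[OF F H H HF]
  proof (intro ballI)
    fix U V assume "U \<in> sets F" "V \<in> sets H"
    moreover from this have "U \<in> sets M" using F by (auto simp: subalgebra_def)
    ultimately show "(LINT x:V|M. indicator U x) = (LINT x:V|M. real_cond_exp M H (indicator U) x)"
      by (intro H.real_cond_exp_intA integrable_bounded) (auto simp: indicator_def)
  qed
qed

text \<open>Under conditional independence, the larger field \<open>F\<close> predicts events of \<open>G\<close> no better
  than \<open>H\<close> does.\<close>

lemma cond_exp_eq_of_cond_indep:
  assumes ci: "cond_indep M F G H" and HF: "sets H \<subseteq> sets F" and V: "V \<in> sets G"
  shows "AE x in M. real_cond_exp M F (indicator V) x = real_cond_exp M H (indicator V) x"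
proof -
  have sub: "subalgebra M F" "subalgebra M G" "subalgebra M H"
    using ci by (auto simp: cond_indep_def)
  interpret F: finite_measure_subalgebra M F
    by unfold_locales (rule sub)
  interpret H: finite_measure_subalgebra M H
    by unfold_locales (rule sub)
  have V'[measurable]: "V \<in> sets M" using V sub by (auto simp: subalgebra_def)
  have bd: "AE x in M. \<bar>indicator U x :: real\<bar> \<le> 1" for U
    by (auto simp: indicator_def)
  show ?thesis
  proof (rule F.real_cond_exp_charact)
    show int: "integrable M (indicator V :: 'a \<Rightarrow> real)"
      by (auto intro!: integrable_bounded simp: bd)
    show "integrable M (real_cond_exp M H (indicator V))"
      by (rule H.real_cond_exp_int(1)[OF int])
    have "subalgebra F H"
      using sub HF by (simp add: subalgebra_def)
    then show "real_cond_exp M H (indicator V) \<in> borel_measurable F"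
      by (rule measurable_from_subalg) simp
    fix U assume U: "U \<in> sets F"
    have [measurable]: "U \<in> sets M" using U sub by (auto simp: subalgebra_def)
    have "(LINT x:U|M. indicator V x) = (LINT x:V|M. indicator U x :: real)"
      by (simp add: set_lebesgue_integral_def mult.commute)
    also have "\<dots> = (LINT x:V|M. real_cond_exp M H (indicator U) x)"
      using ci U V unfolding cond_indep_iff_set_integral[OF sub HF] by simp
    also have "\<dots> = (LINT x:U|M. real_cond_exp M H (indicator V) x)"
      using integral_cond_exp_swap[OF sub(3), of "indicator V" "indicator U"]
      by (simp add: set_lebesgue_integral_def bd mult.commute)
    finally show "(LINT x:U|M. indicator V x) = (LINT x:U|M. real_cond_exp M H (indicator V) x)" .
  qed
qed

text \<open>The Markov chain step. Given the present \<open>H2\<close>, the past \<open>F2\<close> says nothing more about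
  \<open>G\<close>; given \<open>H1\<close>, the earlier past \<open>F1\<close> says nothing more about \<open>H2\<close>. So, given \<open>H1\<close>, the
  field \<open>F1\<close> says nothing more about \<open>G\<close>.\<close>

lemma cond_indep_chain:
  assumes ci1: "cond_indep M F1 H2 H1" and ci2: "cond_indep M F2 G H2"
    and HF1: "sets H1 \<subseteq> sets F1" and HF2: "sets H2 \<subseteq> sets F2" and F12: "sets F1 \<subseteq> sets F2"
  shows "cond_indep M F1 G H1"
proof -
  have sub: "subalgebra M F1" "subalgebra M F2" "subalgebra M G" "subalgebra M H1" "subalgebra M H2"
    using ci1 ci2 by (auto simp: cond_indep_def)
  interpret F2: finite_measure_subalgebra M F2
    by unfold_locales (rule sub)
  interpret H1: finite_measure_subalgebra M H1
    by unfold_locales (rule sub)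
  interpret H2: finite_measure_subalgebra M H2
    by unfold_locales (rule sub)
  have bd: "AE x in M. \<bar>indicator U x :: real\<bar> \<le> 1" for U
    by (auto simp: indicator_def)
  show ?thesis
    unfolding cond_indep_iff_set_integral[OF sub(1,3,4) HF1]
  proof (intro ballI)
    fix U V assume U: "U \<in> sets F1" and V: "V \<in> sets G"
    have [measurable]: "U \<in> sets M" "V \<in> sets M"
      using U V sub by (auto simp: subalgebra_def)
    define \<phi> where "\<phi> = real_cond_exp M H1 (indicator U)"
    have [measurable]: "\<phi> \<in> borel_measurable M" by (simp add: \<phi>_def)
    have \<phi>_bd: "AE x in M. \<bar>\<phi> x\<bar> \<le> 1"
      unfolding \<phi>_def by (rule cond_exp_bounded) (auto simp: sub bd)
    have "subalgebra F2 H1"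
      using sub HF1 F12 by (auto simp: subalgebra_def)
    then have \<phi>_F2: "\<phi> \<in> borel_measurable F2"
      unfolding \<phi>_def by (rule measurable_from_subalg) simp
    \<comment> \<open>The function \<open>\<phi>\<close> need not be \<open>H2\<close>-measurable, so it can stand for \<open>indicator U\<close> only
      after both are projected to \<open>H2\<close>.\<close>
    have \<phi>_H2: "AE x in M. real_cond_exp M H2 (indicator U) x = real_cond_exp M H2 \<phi> x"
    proof (rule H2.real_cond_exp_charact)
      fix D assume D: "D \<in> sets H2"
      have "(LINT x:D|M. indicator U x) = (LINT x:D|M. \<phi> x)"
        using ci1 U D unfolding cond_indep_iff_set_integral[OF sub(1,5,4) HF1] \<phi>_def by simp
      also have "\<dots> = (LINT x:D|M. real_cond_exp M H2 \<phi> x)"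
        by (rule H2.real_cond_exp_intA) (auto intro!: integrable_bounded \<phi>_bd D)
      finally show "(LINT x:D|M. indicator U x) = (LINT x:D|M. real_cond_exp M H2 \<phi> x)" .
    qed (auto intro!: integrable_bounded H2.real_cond_exp_int(1) simp: bd \<phi>_bd)
    have "(LINT x:V|M. indicator U x) = (LINT x:V|M. real_cond_exp M H2 (indicator U) x)"
      using ci2 U V F12 unfolding cond_indep_iff_set_integral[OF sub(2,3,5) HF2] by blast
    also have "\<dots> = (LINT x|M. indicator V x * real_cond_exp M H2 \<phi> x)"
      unfolding set_lebesgue_integral_def
      by (rule integral_cong_AE) (use \<phi>_H2 in \<open>auto elim!: eventually_mono\<close>)
    also have "\<dots> = (LINT x|M. real_cond_exp M H2 (indicator V) x * \<phi> x)"
      by (rule integral_cond_exp_swap) (auto simp: sub bd \<phi>_bd)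
    also have "\<dots> = (LINT x|M. \<phi> x * real_cond_exp M F2 (indicator V) x)"
      by (rule integral_cong_AE)
        (use cond_exp_eq_of_cond_indep[OF ci2 HF2 V] in \<open>auto elim!: eventually_mono\<close>)
    also have "\<dots> = (LINT x|M. \<phi> x * indicator V x)"
      by (rule F2.real_cond_exp_intg(2))
        (auto intro!: integrable_mult_bounded simp: \<phi>_F2 \<phi>_bd bd)
    also have "\<dots> = (LINT x:V|M. real_cond_exp M H1 (indicator U) x)"
      by (simp add: set_lebesgue_integral_def \<phi>_def mult.commute)
    finally show "(LINT x:V|M. indicator U x) = (LINT x:V|M. real_cond_exp M H1 (indicator U) x)" .
  qed
qed

text \<open>Adding the conditioning field to \<open>G\<close> costs nothing: on a rectangle \<open>V \<inter> D\<close> with \<open>D \<in> H\<close>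
  the event \<open>D\<close> can be moved over to \<open>F\<close>, and rectangles generate the join.\<close>

lemma cond_indep_join:
  assumes ci: "cond_indep M F G H" and HF: "sets H \<subseteq> sets F"
  shows "cond_indep M F (sigma (space M) {V \<inter> D |V D. V \<in> sets G \<and> D \<in> sets H}) H"
    (is "cond_indep M F (sigma _ ?R) H")
proof -
  have sub: "subalgebra M F" "subalgebra M G" "subalgebra M H"
    using ci by (auto simp: cond_indep_def)
  interpret H: finite_measure_subalgebra M H
    by unfold_locales (rule sub)
  have sets: "U \<in> sets F \<Longrightarrow> U \<in> sets M" "U \<in> sets G \<Longrightarrow> U \<in> sets M" "U \<in> sets H \<Longrightarrow> U \<in> sets M" for U
    using sub by (auto simp: subalgebra_def)
  have bd: "AE x in M. \<bar>indicator U x :: real\<bar> \<le> 1" for U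
    by (auto simp: indicator_def)
  have R: "?R \<subseteq> sets M" using sets by blast
  then have sets_R: "sets (sigma (space M) ?R) = sigma_sets (space M) ?R"
    using sets.space_closed by (intro sets_measure_of) blast
  have sub_R: "subalgebra M (sigma (space M) ?R)"
    unfolding subalgebra_def sets_R
    using sets.sigma_sets_subset[OF R] by (simp add: space_measure_of_conv)
  have stable: "Int_stable ?R"
  proof (rule Int_stableI)
    fix a b assume "a \<in> ?R" "b \<in> ?R"
    then obtain V D V' D' where "a = V \<inter> D" "b = V' \<inter> D'"
      "V \<in> sets G" "V' \<in> sets G" "D \<in> sets H" "D' \<in> sets H" by blast
    then show "a \<inter> b \<in> ?R"
      by (intro CollectI exI[of _ "V \<inter> V'"] exI[of _ "D \<inter> D'"]) auto
  qed
  show ?thesis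
    unfolding cond_indep_iff_set_integral[OF sub(1) sub_R sub(3) HF] sets_R
  proof (intro ballI)
    fix U W assume U: "U \<in> sets F" and W: "W \<in> sigma_sets (space M) ?R"
    have [measurable]: "U \<in> sets M" using U sets by blast
    have intU: "integrable M (indicator U :: 'a \<Rightarrow> real)"
      by (auto intro!: integrable_bounded simp: bd)
    show "(LINT x:W|M. indicator U x) = (LINT x:W|M. real_cond_exp M H (indicator U) x)"
    proof (rule set_integral_eq_on_sigma_sets[OF intU H.real_cond_exp_int(1)[OF intU] stable R _ _ W])
      show "(LINT x|M. indicator U x) = (LINT x|M. real_cond_exp M H (indicator U) x)"
        by (rule H.real_cond_exp_int(2)[OF intU, symmetric])
      fix A assume "A \<in> ?R"
      then obtain V D where A: "A = V \<inter> D" and V: "V \<in> sets G" and D: "D \<in> sets H" by blast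
      note [measurable] = sets(2)[OF V] sets(3)[OF D] D
      have UD: "U \<inter> D \<in> sets F" using U D HF by blast
      have ce: "AE x in M. real_cond_exp M H (indicator (U \<inter> D)) x
          = indicator D x * real_cond_exp M H (indicator U) x"
        by (rule cond_exp_indicator_Int[OF sub(3) D]) simp
      have "(LINT x:A|M. indicator U x) = (LINT x:V|M. indicator (U \<inter> D) x :: real)"
        by (simp add: A set_lebesgue_integral_def indicator_inter_arith mult_ac)
      also have "\<dots> = (LINT x:V|M. real_cond_exp M H (indicator (U \<inter> D)) x)"
        using ci UD V unfolding cond_indep_iff_set_integral[OF sub HF] by blast
      also have "\<dots> = (LINT x|M. indicator V x * (indicator D x * real_cond_exp M H (indicator U) x))"
        unfolding set_lebesgue_integral_def
        by (rule integral_cong_AE) (use ce in \<open>auto elim!: eventually_mono\<close>)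
      also have "\<dots> = (LINT x:A|M. real_cond_exp M H (indicator U) x)"
        by (simp add: A set_lebesgue_integral_def indicator_inter_arith mult_ac)
      finally show "(LINT x:A|M. indicator U x) = (LINT x:A|M. real_cond_exp M H (indicator U) x)" .
    qed
  qed
qed

end

lemma space_gen_field [simp]: "space (gen_field M Z) = space M"
  by (simp add: gen_field_def)

lemma sets_gen_field: "sets (gen_field M Z) = {Z -` C \<inter> space M |C. C \<in> sets borel}"
  by (simp add: gen_field_def sets_vimage_algebra2)

lemma measurable_gen_field: "Z \<in> borel_measurable (gen_field M Z)"
  by (simp add: gen_field_def measurable_vimage_algebra1)

lemma sets_gen_field_subset:
  assumes "Z \<in> borel_measurable F" "space F = space M"
  shows "sets (gen_field M Z) \<subseteq> sets F"
  using measurable_sets[OF assms(1)] assms(2) by (auto simp: sets_gen_field)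

lemma subalgebra_gen_field: "Z \<in> borel_measurable M \<Longrightarrow> subalgebra M (gen_field M Z)"
  by (simp add: subalgebra_def sets_gen_field_subset)

context prob_space
begin

text \<open>An almost sure identity suffices: replacing a version of \<open>Z\<close> changes each event of its
  generated field by a null set only, and the integral criterion does not see null sets.\<close>

lemma cond_indep_borel_image:
  fixes W Y Z :: "'a \<Rightarrow> real" and h :: "real \<times> real \<Rightarrow> real"
  assumes ci: "cond_indep M F (gen_field M W) (gen_field M Y)"
    and Y: "Y \<in> borel_measurable F"
    and Z: "Z \<in> borel_measurable M"
    and h: "h \<in> borel_measurable borel"
    and ae: "AE x in M. Z x = h (W x, Y x)"
  shows "cond_indep M F (gen_field M Z) (gen_field M Y)"
proof -
  let ?G = "gen_field M W" and ?H = "gen_field M Y"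
  let ?J = "sigma (space M) {V \<inter> D |V D. V \<in> sets ?G \<and> D \<in> sets ?H}"
  have F: "subalgebra M F" and G: "subalgebra M ?G" and H: "subalgebra M ?H"
    using ci by (auto simp: cond_indep_def)
  have HF: "sets ?H \<subseteq> sets F"
    using Y F by (intro sets_gen_field_subset) (auto simp: subalgebra_def)
  have cJ: "cond_indep M F ?J ?H"
    by (rule cond_indep_join[OF ci HF])
  then have J: "subalgebra M ?J" by (simp add: cond_indep_def)
  have gen: "V \<inter> D \<in> sets ?J" if "V \<in> sets ?G" "D \<in> sets ?H" for V D
  proof -
    have "{V \<inter> D |V D. V \<in> sets ?G \<and> D \<in> sets ?H} \<subseteq> Pow (space M)"
      using sets.space_closed[of ?G] by auto
    from sets_measure_of[OF this] show ?thesis using that by auto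
  qed
  have top: "space M \<in> sets ?G" "space M \<in> sets ?H"
    using sets.top[of ?G] sets.top[of ?H] by simp_all
  have "subalgebra ?J ?G" "subalgebra ?J ?H"
    using gen[OF _ top(2)] gen[OF top(1)] sets.sets_into_space[of _ ?G] sets.sets_into_space[of _ ?H]
    by (auto simp: subalgebra_def space_measure_of_conv Int_absorb1 Int_absorb2)
  then have [measurable]: "W \<in> borel_measurable ?J" "Y \<in> borel_measurable ?J"
    by (auto intro: measurable_from_subalg measurable_gen_field)
  have "(\<lambda>x. (W x, Y x)) \<in> ?J \<rightarrow>\<^sub>M borel"
    unfolding borel_prod[symmetric] by measurable
  then have Z'J: "(\<lambda>x. h (W x, Y x)) \<in> borel_measurable ?J"
    using measurable_compose h by blast
  have Z'M: "(\<lambda>x. h (W x, Y x)) \<in> borel_measurable M"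
    by (rule measurable_from_subalg[OF J Z'J])
  have ZM: "subalgebra M (gen_field M Z)" by (rule subalgebra_gen_field[OF Z])
  show ?thesis
    unfolding cond_indep_iff_set_integral[OF F ZM H HF]
  proof (intro ballI)
    fix U V assume U: "U \<in> sets F" and "V \<in> sets (gen_field M Z)"
    then obtain C where C: "C \<in> sets borel" and V: "V = Z -` C \<inter> space M"
      by (auto simp: sets_gen_field)
    have [measurable]: "U \<in> sets M" using U F by (auto simp: subalgebra_def)
    define V' where "V' = (\<lambda>x. h (W x, Y x)) -` C \<inter> space M"
    have V'J: "V' \<in> sets ?J"
      using measurable_sets[OF Z'J C] by (simp add: V'_def space_measure_of_conv)
    have [measurable]: "V \<in> sets M" "V' \<in> sets M"
      using measurable_sets[OF Z C] measurable_sets[OF Z'M C] by (simp_all add: V V'_def)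
    have "AE x in M. (indicator V x :: real) = indicator V' x"
      using ae by eventually_elim (auto simp: V V'_def indicator_def)
    then have eq: "(LINT x:V|M. k x) = (LINT x:V'|M. k x)"
      if "k \<in> borel_measurable M" for k :: "'a \<Rightarrow> real"
      unfolding set_lebesgue_integral_def using that
      by (intro integral_cong_AE) (auto elim!: eventually_mono)
    show "(LINT x:V|M. indicator U x) = (LINT x:V|M. real_cond_exp M ?H (indicator U) x)"
      using cJ U V'J eq unfolding cond_indep_iff_set_integral[OF F J H HF] by simp
  qed
qed

end


section \<open>Inclusion-exclusion and the additive extension\<close>

text \<open>Split the index sets according to whether they contain the new index; those that do
  contribute the singleton term and, with opposite sign, the sum for the traces on \<open>E\<close>.\<close>

lemma incl_excl_Suc:
  "incl_excl Y (Suc n) (D(Suc n := E)) \<omega> =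
    incl_excl Y n D \<omega> + Y E \<omega> - incl_excl Y n (\<lambda>i. D i \<inter> E) \<omega>"
proof -
  let ?D = "D(Suc n := E)"
  let ?N = "{I. I \<subseteq> {1..n} \<and> I \<noteq> {}}"
  let ?t = "\<lambda>I. (-1) ^ (card I + 1) * Y (\<Inter>i\<in>I. ?D i) \<omega>"
  have fin: "finite ?N" by (rule finite_subset[of _ "Pow {1..n}"]) auto
  have atM: "{1..Suc n} = insert (Suc n) {1..n}" by auto
  have split: "{I. I \<subseteq> {1..Suc n} \<and> I \<noteq> {}} = ?N \<union> insert (Suc n) ` insert {} ?N"
  proof (intro equalityI subsetI)
    fix I assume I: "I \<in> {I. I \<subseteq> {1..Suc n} \<and> I \<noteq> {}}"
    show "I \<in> ?N \<union> insert (Suc n) ` insert {} ?N"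
    proof (cases "Suc n \<in> I")
      case True
      then have "I = insert (Suc n) (I - {Suc n})" by auto
      moreover have "I - {Suc n} \<in> insert {} ?N" using I unfolding atM by auto
      ultimately show ?thesis by blast
    next
      case False
      then show ?thesis using I unfolding atM by auto
    qed
  qed (auto simp: atM)
  have inj: "inj_on (insert (Suc n)) (insert {} ?N)"
  proof (rule inj_onI)
    fix I J assume "I \<in> insert {} ?N" "J \<in> insert {} ?N" and eq: "insert (Suc n) I = insert (Suc n) J"
    then have "Suc n \<notin> I" "Suc n \<notin> J" by auto
    then show "I = J" using eq by (simp add: insert_ident)
  qed
  have without: "(\<Sum>I\<in>?N. ?t I) = incl_excl Y n D \<omega>"
    unfolding incl_excl_def
  proof (rule sum.cong)
    fix I assume "I \<in> ?N"
    then have "(\<Inter>i\<in>I. ?D i) = (\<Inter>i\<in>I. D i)" by (intro INF_cong) auto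
    then show "?t I = (-1) ^ (card I + 1) * Y (\<Inter>i\<in>I. D i) \<omega>" by simp
  qed simp
  have "(\<Sum>I\<in>?N. ?t (insert (Suc n) I)) = - incl_excl Y n (\<lambda>i. D i \<inter> E) \<omega>"
    unfolding incl_excl_def sum_negf[symmetric]
  proof (rule sum.cong)
    fix I assume I: "I \<in> ?N"
    then have "finite I" using finite_subset[of I "{1..n}"] by blast
    moreover have "Suc n \<notin> I" using I by auto
    moreover have "(\<Inter>i\<in>insert (Suc n) I. ?D i) = (\<Inter>i\<in>I. D i \<inter> E)"
      using I by (auto split: if_splits)
    ultimately show "?t (insert (Suc n) I) = - ((-1) ^ (card I + 1) * Y (\<Inter>i\<in>I. D i \<inter> E) \<omega>)"
      by simp
  qed simp
  then have with_new: "(\<Sum>I\<in>insert {} ?N. ?t (insert (Suc n) I)) =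
      Y E \<omega> - incl_excl Y n (\<lambda>i. D i \<inter> E) \<omega>"
    using fin by (subst sum.insert) auto
  have "incl_excl Y (Suc n) ?D \<omega> = (\<Sum>I\<in>?N. ?t I) + (\<Sum>I\<in>insert (Suc n) ` insert {} ?N. ?t I)"
    unfolding incl_excl_def split
    by (rule sum.union_disjoint) (use fin in auto)
  also have "(\<Sum>I\<in>insert (Suc n) ` insert {} ?N. ?t I) = (\<Sum>I\<in>insert {} ?N. ?t (insert (Suc n) I))"
    by (rule sum.reindex_cong[OF inj]) auto
  finally show ?thesis unfolding without with_new by (simp only: add_diff_eq)
qed

lemma finite_unions_insert:
  "B \<in> finite_unions \<A> \<Longrightarrow> A \<in> \<A> \<Longrightarrow> A \<union> B \<in> finite_unions \<A>"
  unfolding finite_unions_def by clarsimp (metis Union_insert finite_insert insert_subset)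

lemma finite_unions_Int:
  assumes "\<And>A B. A \<in> \<A> \<Longrightarrow> B \<in> \<A> \<Longrightarrow> A \<inter> B \<in> \<A>" "B \<in> finite_unions \<A>" "A \<in> \<A>"
  shows "A \<inter> B \<in> finite_unions \<A>"
proof -
  obtain \<F> where \<F>: "finite \<F>" "\<F> \<subseteq> \<A>" "B = \<Union>\<F>"
    using assms(2) by (auto simp: finite_unions_def)
  then have "A \<inter> B = \<Union>((\<inter>) A ` \<F>)" by auto
  moreover have "finite ((\<inter>) A ` \<F>)" "(\<inter>) A ` \<F> \<subseteq> \<A>" using \<F> assms by auto
  ultimately show ?thesis unfolding finite_unions_def by blast
qed

text \<open>The empty set is adjoined to the family because a representation has at least one
  member, whereas the empty family is a legitimate finite union.\<close>

lemma union_rep_exists: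
  assumes "{} \<in> \<A>" "S \<in> finite_unions \<A>"
  shows "\<exists>n D. union_rep \<A> S n D"
proof -
  obtain \<F> where \<F>: "finite \<F>" "\<F> \<subseteq> \<A>" "S = \<Union>\<F>"
    using assms(2) by (auto simp: finite_unions_def)
  define n where "n = card (insert {} \<F>)"
  obtain D where "bij_betw D {1..n} (insert {} \<F>)"
    unfolding n_def using ex_bij_betw_nat_finite_1[of "insert {} \<F>"] \<F>(1) by auto
  then have im: "D ` {1..n} = insert {} \<F>" by (rule bij_betw_imp_surj_on)
  have "1 \<le> n" using \<F>(1) by (simp add: n_def Suc_le_eq card_gt_0_iff)
  moreover have "\<forall>i\<in>{1..n}. D i \<in> \<A>"
  proof
    fix i assume "i \<in> {1..n}"
    then have "D i \<in> insert {} \<F>" using im by blast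
    then show "D i \<in> \<A>" using \<F>(2) assms(1) by auto
  qed
  moreover have "S = (\<Union>i\<in>{1..n}. D i)" unfolding im using \<F>(3) by auto
  ultimately show ?thesis unfolding union_rep_def by blast
qed

lemma union_ext_rep:
  assumes "union_rep \<D> S m D'"
  obtains n D where "union_rep \<D> S n D" "union_ext \<D> Y S = incl_excl Y n D"
proof -
  obtain n D where nD: "(SOME (n, D). union_rep \<D> S n D) = (n, D)" by (cases "SOME (n, D). union_rep \<D> S n D") auto
  have "case (n, D) of (n, D) \<Rightarrow> union_rep \<D> S n D"
    unfolding nD[symmetric] by (rule someI[of _ "(m, D')"]) (use assms in simp)
  then show thesis using that nD by (simp add: union_ext_def)
qed

lemma union_ext_AE:
  assumes "union_consistent M \<D> Y" "union_rep \<D> S n D"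
  shows "AE \<omega> in M. union_ext \<D> Y S \<omega> = incl_excl Y n D \<omega>"
  by (rule union_ext_rep[OF assms(2), of Y]) (use assms in \<open>auto simp: union_consistent_def\<close>)

text \<open>Stated for an arbitrary field \<open>N\<close>: it serves both for the ambient space and for the
  history of \<open>S\<close>, the point being that inclusion-exclusion only involves subsets of \<open>S\<close>.\<close>

lemma measurable_union_ext:
  assumes closed: "closed_under_Inter \<D>" and rep: "union_rep \<D> S m D'"
    and meas: "\<And>A. A \<in> \<D> \<Longrightarrow> A \<subseteq> S \<Longrightarrow> Y A \<in> borel_measurable N"
  shows "union_ext \<D> Y S \<in> borel_measurable N"
proof (rule union_ext_rep[OF rep, of Y])
  fix n D assume D: "union_rep \<D> S n D" and eq: "union_ext \<D> Y S = incl_excl Y n D"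
  have "Y (\<Inter>i\<in>I. D i) \<in> borel_measurable N" if "I \<subseteq> {1..n}" "I \<noteq> {}" for I
  proof (rule meas)
    have "D ` I \<noteq> {} \<and> D ` I \<subseteq> \<D>" using D that by (auto simp: union_rep_def)
    then show "(\<Inter>i\<in>I. D i) \<in> \<D>" using closed[unfolded closed_under_Inter_def, rule_format, of "D ` I"] by simp
    show "(\<Inter>i\<in>I. D i) \<subseteq> S" using D that by (auto simp: union_rep_def)
  qed
  then show ?thesis
    unfolding eq incl_excl_def[abs_def] by (intro borel_measurable_sum borel_measurable_times) auto
qed

lemma diff_ext_rep:
  assumes "A \<in> \<A>" "B \<in> finite_unions \<A>"
  obtains A' B' where "diff_rep \<A> (A - B) A' B'"
    "diff_ext \<A> X (A - B) = (\<lambda>\<omega>. X A' \<omega> - union_ext \<A> X (A' \<inter> B') \<omega>)"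
proof -
  obtain A' B' where AB: "(SOME (A', B'). diff_rep \<A> (A - B) A' B') = (A', B')"
    by (cases "SOME (A', B'). diff_rep \<A> (A - B) A' B'") auto
  have "case (A', B') of (A', B') \<Rightarrow> diff_rep \<A> (A - B) A' B'"
    unfolding AB[symmetric] by (rule someI[of _ "(A, B)"]) (use assms in \<open>simp add: diff_rep_def\<close>)
  then show thesis using that AB by (simp add: diff_ext_def)
qed


section \<open>The increment over \<open>A - B\<close> and the filtration\<close>

locale additive_process = prob_space M for M :: "'w measure" +
  fixes \<A> :: "'a set set" and X :: "'a set \<Rightarrow> 'w \<Rightarrow> real"
  assumes empty_mem: "{} \<in> \<A>"
    and closed_Inter: "closed_under_Inter \<A>"
    and process: "set_indexed_process M \<A> X"
    and union_consistent: "union_consistent M \<A> X"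
    and diff_consistent: "diff_consistent M \<A> X"
begin

lemma Int_mem: "A \<in> \<A> \<Longrightarrow> B \<in> \<A> \<Longrightarrow> A \<inter> B \<in> \<A>"
  using closed_Inter[unfolded closed_under_Inter_def, rule_format, of "{A, B}"] by simp

lemma measurable_process: "A \<in> \<A> \<Longrightarrow> X A \<in> borel_measurable M"
  using process by (simp add: set_indexed_process_def)

lemma measurable_ext_union: "B \<in> finite_unions \<A> \<Longrightarrow> union_ext \<A> X B \<in> borel_measurable M"
  using union_rep_exists[OF empty_mem] measurable_union_ext[OF closed_Inter] measurable_process
  by metis

lemma measurable_ext_diff:
  assumes "A \<in> \<A>" "B \<in> finite_unions \<A>"
  shows "diff_ext \<A> X (A - B) \<in> borel_measurable M"
proof (rule diff_ext_rep[OF assms, of X])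
  fix A' B' assume rep: "diff_rep \<A> (A - B) A' B'"
    and eq: "diff_ext \<A> X (A - B) = (\<lambda>\<omega>. X A' \<omega> - union_ext \<A> X (A' \<inter> B') \<omega>)"
  have "X A' \<in> borel_measurable M" "union_ext \<A> X (A' \<inter> B') \<in> borel_measurable M"
    using rep Int_mem
    by (auto simp: diff_rep_def intro!: measurable_process measurable_ext_union finite_unions_Int)
  then show ?thesis unfolding eq by measurable
qed

text \<open>From a representation of \<open>B\<close>, adding \<open>A\<close> represents \<open>A \<union> B\<close> and intersecting with \<open>A\<close>
  represents \<open>A \<inter> B\<close>; the recursion for inclusion-exclusion then gives
  \<open>X (A \<union> B) = X B + X A - X (A \<inter> B)\<close>.\<close>

lemma diff_ext_eq_union_ext_minus:
  assumes A: "A \<in> \<A>" and B: "B \<in> finite_unions \<A>"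
  shows "AE \<omega> in M. diff_ext \<A> X (A - B) \<omega> = union_ext \<A> X (A \<union> B) \<omega> - union_ext \<A> X B \<omega>"
proof -
  obtain n D where D: "union_rep \<A> B n D"
    using union_rep_exists[OF empty_mem B] by blast
  have "{1..Suc n} = insert (Suc n) {1..n}" by auto
  then have rep_union: "union_rep \<A> (A \<union> B) (Suc n) (D(Suc n := A))"
    using D A by (auto simp: union_rep_def)
  have rep_int: "union_rep \<A> (A \<inter> B) n (\<lambda>i. D i \<inter> A)"
    using D A Int_mem by (auto simp: union_rep_def)
  obtain A' B' where rep: "diff_rep \<A> (A - B) A' B'"
    and eq: "diff_ext \<A> X (A - B) = (\<lambda>\<omega>. X A' \<omega> - union_ext \<A> X (A' \<inter> B') \<omega>)"
    by (rule diff_ext_rep[OF A B, of X])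
  have "diff_rep \<A> (A - B) A B" using A B by (simp add: diff_rep_def)
  then have "AE \<omega> in M. diff_ext \<A> X (A - B) \<omega> = X A \<omega> - union_ext \<A> X (A \<inter> B) \<omega>"
    using diff_consistent rep unfolding diff_consistent_def eq by blast
  then show ?thesis
    using union_ext_AE[OF union_consistent D] union_ext_AE[OF union_consistent rep_union]
      union_ext_AE[OF union_consistent rep_int]
    by eventually_elim (simp add: incl_excl_Suc)
qed

lemma min_filtration_generator:
  "(\<Union>A\<in>{A\<in>\<A>. A \<subseteq> B}. sets (gen_field M (X A))) \<union> null_sets M \<subseteq> sets M"
  using subalgebra_gen_field[OF measurable_process] by (auto simp: subalgebra_def)

lemma sets_min_filtration:
  "sets (min_filtration M \<A> X B) =
    sigma_sets (space M) ((\<Union>A\<in>{A\<in>\<A>. A \<subseteq> B}. sets (gen_field M (X A))) \<union> null_sets M)"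
  unfolding min_filtration_def
  using min_filtration_generator sets.space_closed by (intro sets_measure_of) blast

lemma space_min_filtration: "space (min_filtration M \<A> X B) = space M"
  by (simp add: min_filtration_def space_measure_of_conv)

lemma subalgebra_min_filtration: "subalgebra M (min_filtration M \<A> X B)"
  using sets.sigma_sets_subset[OF min_filtration_generator]
  by (simp add: subalgebra_def space_min_filtration sets_min_filtration)

lemma min_filtration_mono:
  "B \<subseteq> B' \<Longrightarrow> sets (min_filtration M \<A> X B) \<subseteq> sets (min_filtration M \<A> X B')"
  unfolding sets_min_filtration by (intro sigma_sets_mono') auto

lemma adapted_union_ext:
  assumes "B \<in> finite_unions \<A>"
  shows "union_ext \<A> X B \<in> borel_measurable (min_filtration M \<A> X B)"
proof -
  obtain n D where D: "union_rep \<A> B n D"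
    using union_rep_exists[OF empty_mem assms] by blast
  show ?thesis
  proof (rule measurable_union_ext[OF closed_Inter D])
    fix A assume "A \<in> \<A>" "A \<subseteq> B"
    then have "subalgebra (min_filtration M \<A> X B) (gen_field M (X A))"
      by (auto simp: subalgebra_def space_min_filtration sets_min_filtration)
    then show "X A \<in> borel_measurable (min_filtration M \<A> X B)"
      by (rule measurable_from_subalg) (rule measurable_gen_field)
  qed
qed

lemma present_subset_past:
  "B \<in> finite_unions \<A> \<Longrightarrow>
    sets (gen_field M (union_ext \<A> X B)) \<subseteq> sets (min_filtration M \<A> X B)"
  by (intro sets_gen_field_subset adapted_union_ext space_min_filtration)

text \<open>Given \<open>X B\<close>, the increment over \<open>A - B\<close> and the value at \<open>A \<union> B\<close> carry the same
  information, each being almost surely a Borel function of the other and of \<open>X B\<close>.\<close>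

lemma cond_indep_increment_iff:
  assumes A: "A \<in> \<A>" and B: "B \<in> finite_unions \<A>"
  shows "cond_indep M (min_filtration M \<A> X B)
      (gen_field M (diff_ext \<A> X (A - B))) (gen_field M (union_ext \<A> X B)) \<longleftrightarrow>
    cond_indep M (min_filtration M \<A> X B)
      (gen_field M (union_ext \<A> X (A \<union> B))) (gen_field M (union_ext \<A> X B))"
    (is "?increment \<longleftrightarrow> ?value")
proof
  note ae = diff_ext_eq_union_ext_minus[OF A B]
  show ?value if ?increment
  proof (rule cond_indep_borel_image[OF that adapted_union_ext[OF B]])
    show "union_ext \<A> X (A \<union> B) \<in> borel_measurable M"
      by (intro measurable_ext_union finite_unions_insert A B)
    show "(\<lambda>p. fst p + snd p) \<in> borel_measurable (borel :: (real \<times> real) measure)"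
      unfolding borel_prod[symmetric] by measurable
    show "AE x in M. union_ext \<A> X (A \<union> B) x =
        fst (diff_ext \<A> X (A - B) x, union_ext \<A> X B x) + snd (diff_ext \<A> X (A - B) x, union_ext \<A> X B x)"
      using ae by eventually_elim simp
  qed
  show ?increment if ?value
  proof (rule cond_indep_borel_image[OF that adapted_union_ext[OF B]])
    show "diff_ext \<A> X (A - B) \<in> borel_measurable M"
      by (intro measurable_ext_diff A B)
    show "(\<lambda>p. fst p - snd p) \<in> borel_measurable (borel :: (real \<times> real) measure)"
      unfolding borel_prod[symmetric] by measurable
    show "AE x in M. diff_ext \<A> X (A - B) x =
        fst (union_ext \<A> X (A \<union> B) x, union_ext \<A> X B x) - snd (union_ext \<A> X (A \<union> B) x, union_ext \<A> X B x)"
      using ae by eventually_elim simp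
  qed
qed

text \<open>The sets of \<open>\<F>\<close> are adjoined to \<open>B\<close> one at a time; each step is a transition of a Markov
  chain.\<close>

lemma set_markov_imp_cond_indep_Union:
  assumes markov: "set_markov M \<A> X" and B: "B \<in> finite_unions \<A>"
    and "finite \<F>" "\<F> \<subseteq> \<A>"
  shows "B \<union> \<Union>\<F> \<in> finite_unions \<A> \<and>
    cond_indep M (min_filtration M \<A> X B)
      (gen_field M (union_ext \<A> X (B \<union> \<Union>\<F>))) (gen_field M (union_ext \<A> X B))"
  using assms(3,4)
proof (induction \<F> rule: finite_induct)
  case empty
  have "cond_indep M (min_filtration M \<A> X B)
      (gen_field M (union_ext \<A> X B)) (gen_field M (union_ext \<A> X B))"
    by (intro cond_indep_self subalgebra_min_filtration subalgebra_gen_field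
        measurable_ext_union present_subset_past B)
  then show ?case using B by simp
next
  case (insert A \<F>)
  let ?C = "B \<union> \<Union>\<F>"
  have A: "A \<in> \<A>" and C: "?C \<in> finite_unions \<A>"
    and ci: "cond_indep M (min_filtration M \<A> X B)
      (gen_field M (union_ext \<A> X ?C)) (gen_field M (union_ext \<A> X B))"
    using insert by auto
  have "cond_indep M (min_filtration M \<A> X ?C)
      (gen_field M (union_ext \<A> X (A \<union> ?C))) (gen_field M (union_ext \<A> X ?C))"
    using markov A C unfolding cond_indep_increment_iff[OF A C, symmetric] set_markov_def by blast
  from cond_indep_chain[OF ci this present_subset_past[OF B] present_subset_past[OF C] min_filtration_mono]
  have "cond_indep M (min_filtration M \<A> X B)
      (gen_field M (union_ext \<A> X (A \<union> ?C))) (gen_field M (union_ext \<A> X B))"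
    by blast
  moreover have "B \<union> \<Union>(insert A \<F>) = A \<union> ?C" by auto
  ultimately show ?case using finite_unions_insert[OF C A] by simp
qed

end


section \<open>The characterization of the set-Markov property\<close>

theorem proposition1:
  fixes T :: "'a topology" and \<A> :: "'a set set"
    and M :: "'w measure" and X :: "'a set \<Rightarrow> 'w \<Rightarrow> real"
  assumes "compact_space T" and "Hausdorff_space T"
    and "indexing_collection T \<A>"
    and "prob_space M" and "complete_measure M"
    and "set_indexed_process M \<A> X"
    and "unique_additive_extension M \<A> X"
  shows "set_markov M \<A> X \<longleftrightarrow>
    (\<forall>B\<in>finite_unions \<A>. \<forall>B'\<in>finite_unions \<A>. B \<subseteq> B' \<longrightarrow>
       cond_indep M (min_filtration M \<A> X B)
         (gen_field M (union_ext \<A> X B')) (gen_field M (union_ext \<A> X B)))"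
proof -
  interpret prob_space M by fact
  interpret additive_process M \<A> X
  proof unfold_locales
    show "{} \<in> \<A>" "closed_under_Inter \<A>"
      using assms(3) unfolding indexing_collection_def by blast+
    show "union_consistent M \<A> X" "diff_consistent M \<A> X"
      using assms(7) unfolding unique_additive_extension_def by blast+
  qed fact
  show ?thesis
  proof (intro iffI ballI impI)
    fix B B' assume markov: "set_markov M \<A> X" and B: "B \<in> finite_unions \<A>"
      and B': "B' \<in> finite_unions \<A>" and "B \<subseteq> B'"
    obtain \<F> where "finite \<F>" "\<F> \<subseteq> \<A>" "B' = \<Union>\<F>"
      using B' by (auto simp: finite_unions_def)
    moreover from this have "B \<union> \<Union>\<F> = B'" using \<open>B \<subseteq> B'\<close> by auto
    ultimately show "cond_indep M (min_filtration M \<A> X B)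
         (gen_field M (union_ext \<A> X B')) (gen_field M (union_ext \<A> X B))"
      using set_markov_imp_cond_indep_Union[OF markov B] by metis
  next
    assume *: "\<forall>B\<in>finite_unions \<A>. \<forall>B'\<in>finite_unions \<A>. B \<subseteq> B' \<longrightarrow>
       cond_indep M (min_filtration M \<A> X B)
         (gen_field M (union_ext \<A> X B')) (gen_field M (union_ext \<A> X B))"
    show "set_markov M \<A> X"
      unfolding set_markov_def
    proof (intro ballI)
      fix A B assume A: "A \<in> \<A>" and B: "B \<in> finite_unions \<A>"
      show "cond_indep M (min_filtration M \<A> X B)
          (gen_field M (diff_ext \<A> X (A - B))) (gen_field M (union_ext \<A> X B))"
        unfolding cond_indep_increment_iff[OF A B]
        using * B finite_unions_insert[OF B A] by blast
    qed
  qed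
qed

end
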